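(* Let $l\ge 1$ and $k$ be integers with $k\ge l+1$. Let $H$ be any graph obtained from two vertex-disjoint complete graphs $K_l$ and $K_1$ by joining the vertices of $K_l$ to the vertex of $K_1$ by an arbitrary set of edges (so $V(H)=V(K_l)\cup V(K_1)$, and the edges of $H$ are those of $K_l$ together with an arbitrary set of edges between $V(K_l)$ and $V(K_1)$). Assume that $H$ is not a copy of $K_{l+1}$. Then $H$ is $k$-Tur\'an-good.
   Context: All graphs are finite and simple. $K_r$ is the complete graph on $r$ vertices. $\mathcal{N}(H,G)$ denotes the number of copies of $H$ in $G$, i.e. the number of (not necessarily induced) subgraphs of $G$ isomorphic to $H$. A graph is $F$-free if it contains no copy of $F$ as a (not necessarily induced) subgraph. $ex(n,H,F)=\max\{\mathcal{N}(H,G): G \text{ is an } n\text{-vertex } F\text{-free graph}\}$. The Tur\'an graph $T_{k-1}(n)$ is the complete $(k-1)$-partite graph on $n$ vertices in which each class has size $\lceil n/(k-1)\rceil$ or $\lfloor n/(k-1)\rfloor$. A graph $H$ that does not contain $K_k$ as a subgraph is called $k$-Tur\'an-good if $ex(n,H,K_k)=\mathcal{N}(H,T_{k-1}(n))$ for every sufficiently large $n$. *)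

theory Defs
  imports Complex_Main "Graph_Theory.Graph_Theory"
begin

text \<open>
  A finite simple graph is a \<open>pair_graph\<close>: a finite, loop-free, symmetric digraph whose arcs are
  ordered pairs, so that an undirected edge is represented by its two orientations.
\<close>

text \<open>Subgraphs are not required to be induced. The condition \<open>pair_graph S\<close> excludes digraphs that
  contain only one orientation of an edge.\<close>

definition copies :: "'b pair_pre_digraph \<Rightarrow> 'a pair_pre_digraph \<Rightarrow> 'a pair_pre_digraph set" where
  "copies H G = {S. pair_graph S \<and> subgraph (with_proj S) (with_proj G)
                      \<and> digraph_iso (with_proj H) (with_proj S)}"

definition num_copies :: "'b pair_pre_digraph \<Rightarrow> 'a pair_pre_digraph \<Rightarrow> nat" where
  "num_copies H G = card (copies H G)"

definition free_of :: "'b pair_pre_digraph \<Rightarrow> 'a pair_pre_digraph \<Rightarrow> bool" where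
  "free_of F G \<longleftrightarrow> copies F G = {}"

definition complete_pair_graph :: "nat \<Rightarrow> nat pair_pre_digraph" where
  "complete_pair_graph r = \<lparr> pverts = {..<r}, parcs = {(u, v). u < r \<and> v < r \<and> u \<noteq> v} \<rparr>"

text \<open>Every \<open>n\<close>-vertex graph is isomorphic to one with vertices in \<^typ>\<open>nat\<close>, so the maximum below
  is over all \<open>n\<close>-vertex graphs up to isomorphism.\<close>

definition turan_number :: "nat \<Rightarrow> 'b pair_pre_digraph \<Rightarrow> 'c pair_pre_digraph \<Rightarrow> nat" where
  "turan_number n H F = Max {num_copies H G | G :: nat pair_pre_digraph.
                     pair_graph G \<and> card (pverts G) = n \<and> free_of F G}"

text \<open>The classes are the fibres of \<open>c\<close>; some of them are empty if \<open>n < r\<close>.\<close>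

definition is_turan_graph :: "nat \<Rightarrow> nat \<Rightarrow> 'a pair_pre_digraph \<Rightarrow> bool" where
  "is_turan_graph r n T \<longleftrightarrow>
     pair_graph T \<and> card (pverts T) = n \<and>
     (\<exists>c :: 'a \<Rightarrow> nat.
        (\<forall>v \<in> pverts T. c v < r) \<and>
        parcs T = {(u, v). u \<in> pverts T \<and> v \<in> pverts T \<and> c u \<noteq> c v} \<and>
        (\<forall>i < r. int (card {v \<in> pverts T. c v = i})
                   \<in> {\<lfloor>real n / real r\<rfloor>, \<lceil>real n / real r\<rceil>}))"

text \<open>Turan graphs are unique only up to isomorphism; the equation is required for all of them.
  They exist by \<open>turan_graph_exists\<close> below.\<close>

definition turan_good :: "nat \<Rightarrow> 'b pair_pre_digraph \<Rightarrow> bool" where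
  "turan_good k H \<longleftrightarrow>
     free_of (complete_pair_graph k) H \<and>
     (\<forall>\<^sub>F n in sequentially. \<forall>T :: nat pair_pre_digraph.
        is_turan_graph (k - 1) n T \<longrightarrow> turan_number n H (complete_pair_graph k) = num_copies H T)"

lemma complete_pair_graph: "K\<^bsub>r\<^esub> (with_proj (complete_pair_graph r))"
  by (auto simp: complete_digraph_pair_def complete_pair_graph_def)

lemma finite_num_copies_values:
  "finite {num_copies H G | G :: nat pair_pre_digraph.
             pair_graph G \<and> card (pverts G) = n \<and> free_of F G}"
proof (rule finite_subset)
  show "{num_copies H G | G :: nat pair_pre_digraph.
           pair_graph G \<and> card (pverts G) = n \<and> free_of F G} \<subseteq> {.. 2 ^ n * 2 ^ (n * n)}"
  proof safe
    fix G :: "nat pair_pre_digraph"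
    assume G: "pair_graph G" and n: "n = card (pverts G)"
    interpret pair_graph G by fact
    let ?P = "Pow (pverts G) \<times> Pow (pverts G \<times> pverts G)"
    have fin: "finite ?P"
      by (simp add: pair_finite_verts)
    have "copies H G \<subseteq> (\<lambda>(V, A). \<lparr> pverts = V, parcs = A \<rparr>) ` ?P"
    proof
      fix S assume "S \<in> copies H G"
      then have "pverts S \<subseteq> pverts G" "parcs S \<subseteq> pverts G \<times> pverts G"
        by (auto simp: copies_def subgraph_def dest: in_arcsD1 in_arcsD2)
      then show "S \<in> (\<lambda>(V, A). \<lparr> pverts = V, parcs = A \<rparr>) ` ?P"
        by (intro image_eqI[where x = "(pverts S, parcs S)"]) auto
    qed
    then have "card (copies H G) \<le> card ((\<lambda>(V, A). \<lparr> pverts = V, parcs = A \<rparr>) ` ?P)"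
      using fin by (intro card_mono) auto
    also have "\<dots> \<le> card ?P"
      using fin by (rule card_image_le)
    also have "\<dots> = 2 ^ card (pverts G) * 2 ^ (card (pverts G) * card (pverts G))"
      by (simp add: card_cartesian_product card_Pow pair_finite_verts)
    finally show "num_copies H G \<le> 2 ^ card (pverts G) * 2 ^ (card (pverts G) * card (pverts G))"
      by (simp add: num_copies_def)
  qed
qed simp

lemma card_residue_class:
  assumes "i < r"
  shows "int (card {v \<in> {..<n::nat}. v mod r = i}) \<in> {\<lfloor>real n / real r\<rfloor>, \<lceil>real n / real r\<rceil>}"
proof -
  have r: "r > 0" using assms by simp
  define q where "q = n div r"
  define s where "s = n mod r"
  have n: "n = q * r + s" and s: "s < r"
    using r by (simp_all add: q_def s_def)
  define m where "m = (if i < s then Suc q else q)"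
  have "{v \<in> {..<n}. v mod r = i} = (\<lambda>j. i + j * r) ` {..<m}"
  proof safe
    fix v assume v: "v < n" "i = v mod r"
    have eq: "v = v mod r + (v div r) * r" by simp
    have "v div r < m"
    proof (rule ccontr)
      assume "\<not> v div r < m"
      then have "m * r \<le> (v div r) * r" by (intro mult_right_mono) auto
      moreover have "v = i + (v div r) * r" using v(2) by simp
      ultimately have "i + m * r \<le> v" by linarith
      moreover have "n \<le> i + m * r" using n s by (cases "i < s") (simp_all add: m_def)
      ultimately show False using v(1) by linarith
    qed
    then show "v \<in> (\<lambda>j. v mod r + j * r) ` {..<m}"
      using eq by blast
  next
    fix j assume j: "j < m"
    show "(i + j * r) mod r = i" using assms by simp
    show "i + j * r < n"
    proof (cases "j < q")
      case True
      then have "Suc j * r \<le> q * r" by (intro mult_right_mono) auto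
      then show ?thesis using assms n by simp
    next
      case False
      then have "j = q" "i < s" using j by (auto simp: m_def split: if_splits)
      then show ?thesis using n by simp
    qed
  qed
  moreover have "inj_on (\<lambda>j. i + j * r) {..<m}"
    using r by (auto simp: inj_on_def)
  ultimately have card: "card {v \<in> {..<n}. v mod r = i} = m"
    by (simp add: card_image)
  have floor: "\<lfloor>real n / real r\<rfloor> = int q"
    by (simp add: floor_divide_of_nat_eq q_def)
  show ?thesis
  proof (cases "i < s")
    case True
    have "\<lceil>real n / real r\<rceil> = int (Suc q)"
      using r s True by (intro ceiling_unique) (auto simp: n field_simps)
    then show ?thesis using True card by (simp add: m_def)
  next
    case False
    then show ?thesis using card floor by (simp add: m_def)
  qed
qed

lemma turan_graph_exists:
  assumes "r > 0"
  shows "\<exists>T :: nat pair_pre_digraph. is_turan_graph r n T"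
proof -
  let ?A = "{(u, v). u \<in> {..<n} \<and> v \<in> {..<n} \<and> u mod r \<noteq> v mod r}"
  let ?T = "\<lparr> pverts = {..<n}, parcs = ?A \<rparr>"
  have "finite ?A"
    by (rule finite_subset[of _ "{..<n} \<times> {..<n}"]) auto
  then have "pair_graph ?T"
    by unfold_locales (auto simp: symmetric_def sym_def)
  then have "is_turan_graph r n ?T"
    unfolding is_turan_graph_def
    using assms card_residue_class[of _ r n]
    by (intro conjI exI[of _ "\<lambda>v. v mod r"]) auto
  then show ?thesis by blast
qed

end

(* Attaching a vertex v to an l-clique L by j edges can be done in (d choose j) ways, where d is the
   number of neighbours of v in L. If d < l, this is at most (l-1 choose j), with equality for d = l-1,
   and the pairs with d = l are the (l+1)-cliques with a distinguished vertex. Hence the number of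
   copies of H is at most a k_l + b k_(l+1), where k_s is the number of s-cliques and a, b >= 0 depend
   on n, l, j and the automorphisms of H only; in a complete multipartite graph d >= l-1 always, so
   equality holds. By Zykov's theorem the Turan graph maximises every k_s. *)

theory Submission
  imports Defs
begin

text \<open>A copy of \<open>H\<close> need not reveal which of its vertices is the attached one.
  Counted instead are triples \<open>(L, v, N)\<close>, with \<open>N\<close> the chosen
  neighbourhood of \<open>v\<close> in \<open>L\<close>. Isomorphisms carry triples to triples, so
  every copy comes from equally many of them, and this factor cancels without being computed. Up to
  this factor, \<open>a = C(l-1, j) (n - l)\<close> and
  \<open>b = (C(l, j) - C(l-1, j)) (l + 1)\<close>; binomials grow with their upper argument, so
  \<open>b\<close> is not negative. Zykov's theorem is proved by induction, deleting an
  \<open>r\<close>-clique with \<open>r = k - 1\<close>, for all clique sizes simultaneously. The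
  obstacle is that a graph without \<open>K_(r+1)\<close> may have no \<open>r\<close>-clique to
  delete; edges are then added until one appears. Every comparison holds for each \<open>n\<close>,
  not only for large \<open>n\<close>. That \<open>H\<close> is not complete excludes the case
  \<open>H = K_k\<close> when \<open>k = l + 1\<close>.\<close>

section \<open>Cliques of a relation on a vertex set\<close>

text \<open>\<open>E\<close> is not confined to \<open>V\<close>: deleting vertices changes
  \<open>V\<close> alone, and \<open>{(u, v). c u \<noteq> c v}\<close> can serve as the edge
  relation of a complete multipartite graph on any vertex set.\<close>

definition cliques :: "'a set \<Rightarrow> 'a rel \<Rightarrow> nat \<Rightarrow> 'a set set" where
  "cliques V E s = {Q. Q \<subseteq> V \<and> card Q = s \<and> (\<forall>u\<in>Q. \<forall>v\<in>Q. u \<noteq> v \<longrightarrow> (u, v) \<in> E)}"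

lemma cliquesI:
  "\<lbrakk>Q \<subseteq> V; card Q = s; \<And>u v. \<lbrakk>u \<in> Q; v \<in> Q; u \<noteq> v\<rbrakk> \<Longrightarrow> (u, v) \<in> E\<rbrakk> \<Longrightarrow> Q \<in> cliques V E s"
  by (simp add: cliques_def)

lemma cliquesD:
  assumes "Q \<in> cliques V E s"
  shows "Q \<subseteq> V" "card Q = s" "\<lbrakk>u \<in> Q; v \<in> Q; u \<noteq> v\<rbrakk> \<Longrightarrow> (u, v) \<in> E"
  using assms by (auto simp: cliques_def)

lemma finite_cliques: "finite V \<Longrightarrow> finite (cliques V E s)"
  by (rule finite_subset[of _ "Pow V"]) (auto simp: cliques_def)

lemma finite_clique: "\<lbrakk>finite V; Q \<in> cliques V E s\<rbrakk> \<Longrightarrow> finite Q"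
  by (auto simp: cliques_def intro: finite_subset)

lemma cliques_mono: "\<lbrakk>U \<subseteq> V; E \<inter> U \<times> U \<subseteq> F\<rbrakk> \<Longrightarrow> cliques U E s \<subseteq> cliques V F s"
  by (rule subsetI, rule cliquesI) (auto dest: cliquesD)

lemma card_clique_le:
  assumes "finite V" "cliques V E (Suc r) = {}" "Q \<in> cliques V E s"
  shows "s \<le> r"
proof (rule ccontr)
  assume "\<not> s \<le> r"
  then have "Suc r \<le> card Q"
    using cliquesD(2)[OF assms(3)] by simp
  then obtain P where "P \<subseteq> Q" "card P = Suc r"
    by (meson obtain_subset_with_card_n)
  then have "P \<in> cliques V E (Suc r)"
    using cliquesD(1,3)[OF assms(3)] by (intro cliquesI) blast+
  with assms(2) show False by simp
qed

section \<open>Zykov's theorem for balanced complete multipartite graphs\<close>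

text \<open>An \<open>s\<close>-clique \<open>C\<close> splits into \<open>M = C - Q\<close> and
  \<open>I = C \<inter> Q\<close>. Since \<open>Q\<close> is itself a clique, \<open>I\<close> can
  be any set of \<open>s - m\<close> common neighbours of \<open>M\<close> in
  \<open>Q\<close>.\<close>

lemma card_cliques_split:
  assumes fin: "finite V" and sym: "sym E" and Q: "Q \<in> cliques V E r"
  shows "card (cliques V E s) =
    (\<Sum>m\<le>s. \<Sum>M\<in>cliques (V - Q) E m. card {q \<in> Q. \<forall>u\<in>M. (u, q) \<in> E} choose (s - m))"
proof -
  let ?N = "\<lambda>M. {q \<in> Q. \<forall>u\<in>M. (u, q) \<in> E}"
  let ?X = "SIGMA m:{..s}. cliques (V - Q) E m"
  let ?Y = "\<lambda>(m, M). {I. I \<subseteq> ?N M \<and> card I = s - m}"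
  note finQ = finite_clique[OF fin Q]
  have "bij_betw (\<lambda>((m, M), I). M \<union> I) (Sigma ?X ?Y) (cliques V E s)"
  proof (rule bij_betw_byWitness[where f' = "\<lambda>C. ((card (C - Q), C - Q), C \<inter> Q)"])
    show "\<forall>a\<in>Sigma ?X ?Y. (\<lambda>C. ((card (C - Q), C - Q), C \<inter> Q)) ((\<lambda>((m, M), I). M \<union> I) a) = a"
    proof
      fix a assume "a \<in> Sigma ?X ?Y"
      then obtain m M I where a: "a = ((m, M), I)"
        and M: "M \<in> cliques (V - Q) E m" and I: "I \<subseteq> ?N M"
        by blast
      have "M \<union> I - Q = M" "(M \<union> I) \<inter> Q = I"
        using cliquesD(1)[OF M] I by auto
      then show "(\<lambda>C. ((card (C - Q), C - Q), C \<inter> Q)) ((\<lambda>((m, M), I). M \<union> I) a) = a"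
        using cliquesD(2)[OF M] by (simp add: a)
    qed
    show "\<forall>C\<in>cliques V E s. (\<lambda>((m, M), I). M \<union> I) ((card (C - Q), C - Q), C \<inter> Q) = C"
      by auto
    have "M \<union> I \<in> cliques V E s"
      if "m \<le> s" and M: "M \<in> cliques (V - Q) E m" and I: "I \<subseteq> ?N M" "card I = s - m" for m M I
    proof -
      have "finite M" "finite I"
        using finite_clique[OF _ M] fin finQ I(1) by (auto intro: finite_subset)
      moreover have "M \<inter> I = {}" using cliquesD(1)[OF M] I by auto
      ultimately have "card (M \<union> I) = s"
        using cliquesD(2)[OF M] I(2) \<open>m \<le> s\<close> by (simp add: card_Un_disjoint)
      moreover have "M \<union> I \<subseteq> V"
        using cliquesD(1)[OF M] cliquesD(1)[OF Q] I(1) by blast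
      moreover have "(u, v) \<in> E" if "u \<in> M \<union> I" "v \<in> M \<union> I" "u \<noteq> v" for u v
      proof -
        have "(u, v) \<in> E" if "u \<in> M" "v \<in> I" for u v
          using that I(1) by blast
        with that symD[OF sym] cliquesD(3)[OF M] cliquesD(3)[OF Q] I(1) show ?thesis by blast
      qed
      ultimately show ?thesis
        by (intro cliquesI)
    qed
    then show "(\<lambda>((m, M), I). M \<union> I) ` Sigma ?X ?Y \<subseteq> cliques V E s"
      by auto
    have "((card (C - Q), C - Q), C \<inter> Q) \<in> Sigma ?X ?Y" if C: "C \<in> cliques V E s" for C
    proof -
      have "card C = card (C - Q) + card (C \<inter> Q)"
        using card_Int_Diff[OF finite_clique[OF fin C], of Q] by simp
      moreover have "C - Q \<in> cliques (V - Q) E (card (C - Q))"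
        using cliquesD(1,3)[OF C] by (intro cliquesI) auto
      moreover have "C \<inter> Q \<subseteq> ?N (C - Q)"
        using cliquesD(3)[OF C] by blast
      ultimately show ?thesis
        using cliquesD(2)[OF C] by auto
    qed
    then show "(\<lambda>C. ((card (C - Q), C - Q), C \<inter> Q)) ` cliques V E s \<subseteq> Sigma ?X ?Y"
      by blast
  qed
  then have "card (cliques V E s) = card (Sigma ?X ?Y)"
    by (rule bij_betw_same_card[symmetric])
  also have "\<dots> = (\<Sum>x\<in>?X. card (?Y x))"
    using fin finQ by (intro card_SigmaI) (auto intro: finite_cliques)
  also have "\<dots> = (\<Sum>m\<le>s. \<Sum>M\<in>cliques (V - Q) E m. card (?Y (m, M)))"
    using fin by (subst sum.Sigma) (auto intro: finite_cliques sum.cong)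
  also have "\<dots> = (\<Sum>m\<le>s. \<Sum>M\<in>cliques (V - Q) E m. card (?N M) choose (s - m))"
    using finQ by (simp add: n_subsets)
  finally show ?thesis .
qed

text \<open>\<open>M\<close> together with its common neighbours in \<open>Q\<close> is again a
  clique, hence has at most \<open>r\<close> vertices.\<close>

lemma card_common_neighbours_le:
  assumes fin: "finite V" and sym: "sym E" and free: "cliques V E (Suc r) = {}"
    and Q: "Q \<in> cliques V E r" and M: "M \<in> cliques (V - Q) E m"
  shows "card {q \<in> Q. \<forall>u\<in>M. (u, q) \<in> E} \<le> r - m"
proof -
  let ?N = "{q \<in> Q. \<forall>u\<in>M. (u, q) \<in> E}"
  have "finite M" "finite ?N" "M \<inter> ?N = {}"
    using finite_clique[OF _ M] finite_clique[OF _ Q] fin cliquesD(1)[OF M] by auto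
  then have "card (M \<union> ?N) = m + card ?N"
    using cliquesD(2)[OF M] by (simp add: card_Un_disjoint)
  then have "M \<union> ?N \<in> cliques V E (m + card ?N)"
    using cliquesD(1,3)[OF M] cliquesD(1,3)[OF Q] symD[OF sym]
    by (intro cliquesI) blast+
  then show ?thesis
    using card_clique_le[OF fin free] by fastforce
qed

text \<open>As long as there is no \<open>r\<close>-clique, adding one missing edge creates no
  \<open>(r+1)\<close>-clique: dropping an end of the new edge from it would leave an
  \<open>r\<close>-clique of the old graph. The number of missing pairs decreases, so an
  \<open>r\<close>-clique appears eventually.\<close>

lemma exists_clique_supergraph:
  assumes "finite V" "sym E" "cliques V E (Suc r) = {}" "r \<le> card V"
  shows "\<exists>F. E \<subseteq> F \<and> sym F \<and> cliques V F (Suc r) = {} \<and> cliques V F r \<noteq> {}"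
  using assms
proof (induction "card (V \<times> V - E)" arbitrary: E rule: less_induct)
  case less
  show ?case
  proof (cases "cliques V E r = {}")
    case False
    with less.prems show ?thesis by blast
  next
    case True
    obtain U where "U \<subseteq> V" "card U = r"
      using less.prems(4) by (meson obtain_subset_with_card_n)
    with True obtain u v where uv: "u \<in> V" "v \<in> V" "u \<noteq> v" "(u, v) \<notin> E"
      by (metis cliquesI empty_iff subsetD)
    define F where "F = E \<union> {(u, v), (v, u)}"
    have symF: "sym F"
      using less.prems(2) by (auto simp: F_def sym_def)
    have "cliques V F (Suc r) = {}"
    proof (rule ccontr)
      assume "cliques V F (Suc r) \<noteq> {}"
      then obtain Q where Q: "Q \<in> cliques V F (Suc r)" by blast
      have "Q \<noteq> {}" using cliquesD(2)[OF Q] by auto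
      \<comment> \<open>\<open>x\<close> is \<open>u\<close> if \<open>u\<close> lies in
        \<open>Q\<close>, and any vertex of \<open>Q\<close> otherwise; either way
        \<open>Q - {x}\<close> avoids the new edge.\<close>
      then obtain x where x: "x \<in> Q" "u \<notin> Q - {x}"
        by (cases "u \<in> Q") auto
      have "finite Q" using finite_clique[OF less.prems(1) Q] .
      then have "Q - {x} \<in> cliques V E r"
        using x cliquesD[OF Q] by (intro cliquesI) (auto simp: F_def)
      with True show False by simp
    qed
    moreover have "card (V \<times> V - F) < card (V \<times> V - E)"
      using less.prems(1) uv by (intro psubset_card_mono) (auto simp: F_def)
    ultimately obtain F' where "F \<subseteq> F'" "sym F'" "cliques V F' (Suc r) = {}" "cliques V F' r \<noteq> {}"
      using less.hyps[of F] symF less.prems by blast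
    then show ?thesis by (intro exI[of _ F']) (auto simp: F_def)
  qed
qed

lemma card_eq_sum_fibres:
  assumes "finite W" "\<forall>w\<in>W. c w < (r::nat)"
  shows "card W = (\<Sum>i<r. card {w \<in> W. c w = i})"
proof -
  have "card W = (\<Sum>w\<in>W. 1)" by simp
  also have "\<dots> = (\<Sum>i<r. \<Sum>w\<in>{w \<in> W. c w = i}. 1)"
    using assms by (intro sum.group[symmetric]) auto
  finally show ?thesis by simp
qed

text \<open>A class with two vertices forces all \<open>r\<close> classes to be nonempty, which
  takes at least \<open>r\<close> vertices. This is the base case of the induction: the multipartite
  graph is then complete.\<close>

lemma balanced_inj_on:
  assumes fin: "finite W" and c: "\<forall>w\<in>W. c w < (r::nat)"
    and bal: "\<forall>i<r. \<forall>j<r. card {w \<in> W. c w = i} \<le> Suc (card {w \<in> W. c w = j})"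
    and less: "card W < r"
  shows "inj_on c W"
proof (rule inj_onI, rule ccontr)
  fix x y assume xy: "x \<in> W" "y \<in> W" "c x = c y" "x \<noteq> y"
  have "card {x, y} \<le> card {w \<in> W. c w = c x}"
    using fin xy by (intro card_mono) auto
  then have two: "2 \<le> card {w \<in> W. c w = c x}" using xy by simp
  have "1 \<le> card {w \<in> W. c w = j}" if "j < r" for j
  proof -
    have "card {w \<in> W. c w = c x} \<le> Suc (card {w \<in> W. c w = j})"
      using bal c xy(1) that by blast
    with two show ?thesis by linarith
  qed
  then have "(\<Sum>i<r. 1) \<le> (\<Sum>i<r. card {w \<in> W. c w = i})"
    by (intro sum_mono) auto
  then show False
    using card_eq_sum_fibres[OF fin c] less by simp
qed

text \<open>An empty class limits all others to one vertex, fewer than \<open>r\<close> in total.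
  Nonempty classes provide the transversal that is deleted in the induction.\<close>

lemma balanced_fibre_nonempty:
  assumes fin: "finite W" and c: "\<forall>w\<in>W. c w < (r::nat)"
    and bal: "\<forall>i<r. \<forall>j<r. card {w \<in> W. c w = i} \<le> Suc (card {w \<in> W. c w = j})"
    and le: "r \<le> card W" and j: "j < r"
  shows "{w \<in> W. c w = j} \<noteq> {}"
proof
  assume "{w \<in> W. c w = j} = {}"
  then have j0: "card {w \<in> W. c w = j} = 0" by (simp only: card.empty)
  then have "card {w \<in> W. c w = i} \<le> 1" if "i < r" for i
    using bal j that by fastforce
  then have "(\<Sum>i<r. card {w \<in> W. c w = i}) < (\<Sum>i<r. 1)"
    using j j0 by (intro sum_strict_mono_ex1) auto
  then show False
    using card_eq_sum_fibres[OF fin c] le by simp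
qed

lemma inj_on_clique:
  "M \<in> cliques W {(u, v). c u \<noteq> c v} m \<Longrightarrow> inj_on c M"
  by (auto simp: cliques_def inj_on_def)

text \<open>Deleting an \<open>r\<close>-clique from the \<open>K\<^sub>r\<^sub>+\<^sub>1\<close>-free graph and a transversal of the classes from the
  Turan graph reduces \<open>n\<close> to \<open>n - r\<close>; every clique that is left extends into the deleted set in at
  least as many ways in the Turan graph.\<close>

theorem card_cliques_le_turan:
  assumes "finite V" "finite W" "card V = card W" "sym E" "cliques V E (Suc r) = {}"
    and "\<forall>w\<in>W. c w < r"
    and "\<forall>i<r. \<forall>j<r. card {w \<in> W. c w = i} \<le> Suc (card {w \<in> W. c w = j})"
    and "r > 0"
  shows "card (cliques V E s) \<le> card (cliques W {(u, v). c u \<noteq> c v} s)"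
  using assms
proof (induction "card W" arbitrary: V W E s rule: less_induct)
  case less
  note finV = less.prems(1) and finW = less.prems(2) and c = less.prems(6) and bal = less.prems(7)
  let ?C = "{(u, v). c u \<noteq> c v}"
  have symC: "sym ?C" by (auto simp: sym_def)
  show ?case
  proof (cases "card W < r")
    case True
    have "cliques W ?C s = {Q. Q \<subseteq> W \<and> card Q = s}"
      using balanced_inj_on[OF finW c bal True] by (auto simp: cliques_def inj_on_def)
    then have "card (cliques W ?C s) = card V choose s"
      using n_subsets[OF finW] less.prems(3) by simp
    moreover have "card (cliques V E s) \<le> card {Q. Q \<subseteq> V \<and> card Q = s}"
      using finV by (intro card_mono) (auto simp: cliques_def)
    ultimately show ?thesis
      using n_subsets[OF finV] by simp
  next
    case False
    then have le: "r \<le> card W" by simp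
    with less.prems(3) have leV: "r \<le> card V" by simp
    \<comment> \<open>\<open>F\<close> replaces \<open>E\<close> from here on: more edges only raise
      the clique counts, and \<open>F\<close> has an \<open>r\<close>-clique to delete.\<close>
    obtain F Q where F: "E \<subseteq> F" "sym F" "cliques V F (Suc r) = {}" and Q: "Q \<in> cliques V F r"
      using exists_clique_supergraph[OF finV less.prems(4,5) leV] by blast
    have "\<forall>j\<in>{..<r}. \<exists>w. w \<in> W \<and> c w = j"
      using balanced_fibre_nonempty[OF finW c bal le] by auto
    then obtain t where t: "\<And>j. j < r \<Longrightarrow> t j \<in> W \<and> c (t j) = j"
      by (metis lessThan_iff)
    define R where "R = t ` {..<r}"
    have inj_t: "inj_on t {..<r}"
      using t by (metis inj_onI lessThan_iff)
    have RW: "R \<subseteq> W" and cR: "card R = r" and inj_R: "inj_on c R" and im_R: "c ` R = {..<r}"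
      using t inj_t by (auto simp: R_def card_image inj_on_def image_image)
    have R: "R \<in> cliques W ?C r"
      using RW cR inj_R by (auto simp: cliques_def inj_on_def)
    have finR: "finite R" using RW finW finite_subset by blast
    \<comment> \<open>Each class loses exactly its representative \<open>t i\<close>, so the
      remaining classes are still balanced.\<close>
    have fibre: "card {w \<in> W. c w = i} = Suc (card {w \<in> W - R. c w = i})" if "i < r" for i
    proof -
      have "{w \<in> W. c w = i} = insert (t i) {w \<in> W - R. c w = i}"
        using t that by (auto simp: R_def)
      moreover have "t i \<notin> {w \<in> W - R. c w = i}" using that by (simp add: R_def)
      ultimately show ?thesis using finW by simp
    qed
    have freeVQ: "cliques (V - Q) F (Suc r) = {}"
      using cliques_mono[of "V - Q" V F F "Suc r"] F(3) by auto
    have card_eq: "card (V - Q) = card (W - R)"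
      using finV finW cliquesD(1,2)[OF Q] RW cR less.prems(3) finite_clique[OF finV Q] finR
      by (simp add: card_Diff_subset)
    have small: "card (W - R) < card W"
      using RW cR finW finR le \<open>r > 0\<close> by (simp add: card_Diff_subset)
    have IH: "card (cliques (V - Q) F m) \<le> card (cliques (W - R) ?C m)" for m
    proof (rule less.hyps[OF small _ _ card_eq F(2) freeVQ _ _ \<open>r > 0\<close>])
      show "\<forall>i<r. \<forall>j<r. card {w \<in> W - R. c w = i} \<le> Suc (card {w \<in> W - R. c w = j})"
        using bal fibre by simp
    qed (use finV finW c in auto)
    \<comment> \<open>\<open>M\<close> occupies \<open>m\<close> different classes; its common
      neighbours in the transversal \<open>R\<close> represent the other
      \<open>r - m\<close>.\<close>
    have ext: "card {q \<in> R. \<forall>u\<in>M. (u, q) \<in> ?C} = r - m" if M: "M \<in> cliques (W - R) ?C m" for M m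
    proof -
      have "c ` {q \<in> R. \<forall>u\<in>M. (u, q) \<in> ?C} = {..<r} - c ` M"
      proof -
        have "c ` {q \<in> R. \<forall>u\<in>M. (u, q) \<in> ?C} = c ` R - c ` M"
          by (auto simp: image_iff) metis+
        then show ?thesis by (simp only: im_R)
      qed
      then have "card {q \<in> R. \<forall>u\<in>M. (u, q) \<in> ?C} = card ({..<r} - c ` M)"
        using inj_R by (metis (no_types, lifting) card_image inj_on_subset mem_Collect_eq subsetI)
      also have "\<dots> = r - m"
        using c cliquesD(1,2)[OF M] inj_on_clique[OF M] finite_clique[OF _ M] finW
        by (subst card_Diff_subset) (auto simp: card_image)
      finally show ?thesis .
    qed
    have "card (cliques V E s) \<le> card (cliques V F s)"
      using F(1) finV by (intro card_mono finite_cliques cliques_mono) auto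
    also have "\<dots> = (\<Sum>m\<le>s. \<Sum>M\<in>cliques (V - Q) F m.
        card {q \<in> Q. \<forall>u\<in>M. (u, q) \<in> F} choose (s - m))"
      by (rule card_cliques_split[OF finV F(2) Q])
    \<comment> \<open>The weight now depends on \<open>m\<close> alone, so the induction hypothesis
      applies to each clique size separately.\<close>
    also have "\<dots> \<le> (\<Sum>m\<le>s. \<Sum>M\<in>cliques (V - Q) F m. (r - m) choose (s - m))"
      by (intro sum_mono binomial_right_mono card_common_neighbours_le[OF finV F(2,3) Q])
    also have "\<dots> \<le> (\<Sum>m\<le>s. \<Sum>M\<in>cliques (W - R) ?C m. (r - m) choose (s - m))"
      using IH by (auto intro!: sum_mono)
    also have "\<dots> = (\<Sum>m\<le>s. \<Sum>M\<in>cliques (W - R) ?C m.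
        card {q \<in> R. \<forall>u\<in>M. (u, q) \<in> ?C} choose (s - m))"
      by (intro sum.cong refl) (simp only: ext)
    also have "\<dots> = card (cliques W ?C s)"
      by (rule card_cliques_split[OF finW symC R, symmetric])
    finally show ?thesis .
  qed
qed

section \<open>Counting vertices attached to cliques\<close>

text \<open>Recording \<open>L\<close> and \<open>N\<close> as sets rather than as embeddings
  already divides out the permutations within \<open>N\<close> and within
  \<open>L - N\<close>.\<close>

definition attachments :: "'a set \<Rightarrow> 'a rel \<Rightarrow> nat \<Rightarrow> nat \<Rightarrow> ('a set \<times> 'a \<times> 'a set) set" where
  "attachments V E l j =
    (SIGMA L:cliques V E l. SIGMA v:V - L. {N. N \<subseteq> {u \<in> L. (u, v) \<in> E} \<and> card N = j})"

lemma card_attachments: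
  assumes "finite V"
  shows "card (attachments V E l j) =
    (\<Sum>L\<in>cliques V E l. \<Sum>v\<in>V - L. card {u \<in> L. (u, v) \<in> E} choose j)"
proof -
  have "finite {u \<in> L. (u, v) \<in> E}" if "L \<in> cliques V E l" for L v
    using finite_clique[OF assms that] by simp
  then show ?thesis
    using assms unfolding attachments_def
    by (subst card_SigmaI) (auto simp: finite_cliques n_subsets intro!: sum.cong card_SigmaI)
qed

lemma sum_common_neighbours:
  assumes fin: "finite V" and sym: "sym E"
  shows "(\<Sum>L\<in>cliques V E l. card {v \<in> V - L. \<forall>u\<in>L. (u, v) \<in> E}) =
    Suc l * card (cliques V E (Suc l))"
proof -
  let ?A = "SIGMA L:cliques V E l. {v \<in> V - L. \<forall>u\<in>L. (u, v) \<in> E}"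
  let ?B = "SIGMA Q:cliques V E (Suc l). Q"
  have "bij_betw (\<lambda>(L, v). (insert v L, v)) ?A ?B"
  proof (rule bij_betw_byWitness[where f' = "\<lambda>(Q, v). (Q - {v}, v)"])
    show "\<forall>a\<in>?A. (\<lambda>(Q, v). (Q - {v}, v)) ((\<lambda>(L, v). (insert v L, v)) a) = a"
      by auto
    show "\<forall>a\<in>?B. (\<lambda>(L, v). (insert v L, v)) ((\<lambda>(Q, v). (Q - {v}, v)) a) = a"
      by auto
    have "insert v L \<in> cliques V E (Suc l)"
      if L: "L \<in> cliques V E l" and v: "v \<in> V - L" "\<forall>u\<in>L. (u, v) \<in> E" for L v
    proof (rule cliquesI)
      show "insert v L \<subseteq> V" using cliquesD(1)[OF L] v(1) by simp
      show "card (insert v L) = Suc l"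
        using cliquesD(2)[OF L] finite_clique[OF fin L] v(1) by simp
      show "(x, y) \<in> E" if "x \<in> insert v L" "y \<in> insert v L" "x \<noteq> y" for x y
        using that v(2) symD[OF sym] cliquesD(3)[OF L] by blast
    qed
    then show "(\<lambda>(L, v). (insert v L, v)) ` ?A \<subseteq> ?B"
      by auto
    have "Q - {v} \<in> cliques V E l" if Q: "Q \<in> cliques V E (Suc l)" and v: "v \<in> Q" for Q v
    proof (rule cliquesI)
      show "Q - {v} \<subseteq> V" using cliquesD(1)[OF Q] by blast
      show "card (Q - {v}) = l" using cliquesD(2)[OF Q] v by simp
      show "(x, y) \<in> E" if "x \<in> Q - {v}" "y \<in> Q - {v}" "x \<noteq> y" for x y
        using that cliquesD(3)[OF Q] by blast
    qed
    moreover have "v \<in> V \<and> (\<forall>u\<in>Q - {v}. (u, v) \<in> E)"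
      if "Q \<in> cliques V E (Suc l)" and "v \<in> Q" for Q v
      using cliquesD[OF that(1)] that(2) by auto
    ultimately have "(Q - {v}, v) \<in> ?A" if "Q \<in> cliques V E (Suc l)" and "v \<in> Q" for Q v
      using that by simp
    then show "(\<lambda>(Q, v). (Q - {v}, v)) ` ?B \<subseteq> ?A"
      by auto
  qed
  then have "card ?A = card ?B"
    by (rule bij_betw_same_card)
  moreover have "card ?A = (\<Sum>L\<in>cliques V E l. card {v \<in> V - L. \<forall>u\<in>L. (u, v) \<in> E})"
    using fin by (intro card_SigmaI) (auto simp: finite_cliques)
  moreover have "card ?B = (\<Sum>Q\<in>cliques V E (Suc l). card Q)"
    using fin by (intro card_SigmaI) (auto simp: finite_cliques intro: finite_clique)
  moreover have "\<dots> = Suc l * card (cliques V E (Suc l))"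
    by (simp add: cliques_def)
  ultimately show ?thesis by simp
qed

text \<open>The value of \<^term>\<open>card (attachments V E l j)\<close> if every vertex is adjacent to at least
  \<open>l - 1\<close> vertices of every \<open>l\<close>-clique not containing it.\<close>

definition attachment_bound :: "'a set \<Rightarrow> 'a rel \<Rightarrow> nat \<Rightarrow> nat \<Rightarrow> nat" where
  "attachment_bound V E l j =
    ((l - 1) choose j) * (card V - l) * card (cliques V E l) +
    ((l choose j) - ((l - 1) choose j)) * (Suc l * card (cliques V E (Suc l)))"

text \<open>Every pair \<open>(L, v)\<close> is charged \<open>(l - 1) choose j\<close>, and the
  surplus goes to the pairs that span an \<open>(l+1)\<close>-clique. In this form the bound is
  compared with \<open>card_attachments\<close> term by term.\<close>

lemma attachment_bound_eq_sum:
  assumes fin: "finite V" and sym: "sym E"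
  shows "attachment_bound V E l j = (\<Sum>L\<in>cliques V E l. \<Sum>v\<in>V - L.
    (if \<forall>u\<in>L. (u, v) \<in> E then l choose j else (l - 1) choose j))"
proof -
  let ?a = "(l - 1) choose j" and ?b = "(l choose j) - ((l - 1) choose j)"
  \<comment> \<open>Monotonicity of the binomial ensures that the natural-number difference
    \<open>?b\<close> is not truncated.\<close>
  have ab: "l choose j = ?a + ?b"
    using binomial_right_mono[of "l - 1" l j] by simp
  have inner: "(\<Sum>v\<in>V - L. (if \<forall>u\<in>L. (u, v) \<in> E then l choose j else ?a)) =
      ?a * (card V - l) + ?b * card {v \<in> V - L. \<forall>u\<in>L. (u, v) \<in> E}"
    if L: "L \<in> cliques V E l" for L
  proof -
    have "(\<Sum>v\<in>V - L. (if \<forall>u\<in>L. (u, v) \<in> E then l choose j else ?a)) =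
        (\<Sum>v\<in>V - L. ?a + (if \<forall>u\<in>L. (u, v) \<in> E then ?b else 0))"
      using ab by (intro sum.cong) auto
    also have "\<dots> = ?a * card (V - L) + ?b * card {v \<in> V - L. \<forall>u\<in>L. (u, v) \<in> E}"
      using fin by (simp add: sum.distrib sum.If_cases Int_def conj_commute)
    also have "card (V - L) = card V - l"
      using cliquesD(1,2)[OF L] finite_clique[OF fin L] by (simp add: card_Diff_subset)
    finally show ?thesis .
  qed
  have "(\<Sum>L\<in>cliques V E l. \<Sum>v\<in>V - L. (if \<forall>u\<in>L. (u, v) \<in> E then l choose j else ?a)) =
      (\<Sum>L\<in>cliques V E l. ?a * (card V - l) + ?b * card {v \<in> V - L. \<forall>u\<in>L. (u, v) \<in> E})"
    by (intro sum.cong inner refl)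
  also have "\<dots> = ?a * (card V - l) * card (cliques V E l) +
      ?b * (Suc l * card (cliques V E (Suc l)))"
    unfolding sum.distrib sum_distrib_left[symmetric] sum_common_neighbours[OF fin sym] by simp
  finally show ?thesis
    by (simp add: attachment_bound_def)
qed

lemma card_attachments_le:
  assumes fin: "finite V" and sym: "sym E"
  shows "card (attachments V E l j) \<le> attachment_bound V E l j"
  unfolding card_attachments[OF fin] attachment_bound_eq_sum[OF fin sym]
proof (intro sum_mono)
  fix L v assume L: "L \<in> cliques V E l"
  let ?N = "{u \<in> L. (u, v) \<in> E}"
  note finL = finite_clique[OF fin L]
  show "card ?N choose j \<le> (if \<forall>u\<in>L. (u, v) \<in> E then l choose j else (l - 1) choose j)"
  proof (cases "\<forall>u\<in>L. (u, v) \<in> E")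
    case True
    then have "?N = L" by auto
    then show ?thesis using True cliquesD(2)[OF L] by simp
  next
    case False
    then have "?N \<subset> L" by auto
    then have "card ?N < l"
      using psubset_card_mono[OF finL] cliquesD(2)[OF L] by metis
    then have "card ?N choose j \<le> (l - 1) choose j"
      by (intro binomial_right_mono) simp
    with False show ?thesis by (simp only: if_False)
  qed
qed

text \<open>A clique has at most one vertex in the class of \<open>v\<close>, so \<open>v\<close>
  misses at most one vertex of \<open>L\<close>. The bound is exact in both cases.\<close>

lemma card_attachments_multipartite:
  assumes fin: "finite V"
  shows "card (attachments V {(u, v). c u \<noteq> c v} l j) = attachment_bound V {(u, v). c u \<noteq> c v} l j"
proof -
  let ?C = "{(u, v). c u \<noteq> c v}"
  have sym: "sym ?C" by (auto simp: sym_def)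
  show ?thesis
    unfolding card_attachments[OF fin] attachment_bound_eq_sum[OF fin sym]
  proof (intro sum.cong refl)
    fix L v assume L: "L \<in> cliques V ?C l"
    let ?N = "{u \<in> L. (u, v) \<in> ?C}"
    note finL = finite_clique[OF fin L]
    show "card ?N choose j = (if \<forall>u\<in>L. (u, v) \<in> ?C then l choose j else (l - 1) choose j)"
    proof (cases "\<forall>u\<in>L. (u, v) \<in> ?C")
      case True
      then have "?N = L" by auto
      then show ?thesis using True cliquesD(2)[OF L] by simp
    next
      case False
      then obtain w where w: "w \<in> L" "c w = c v" by auto
      have "?N = L - {w}"
        using w inj_on_clique[OF L] by (auto simp: inj_on_def)
      then have "card ?N = l - 1"
        using w(1) cliquesD(2)[OF L] by simp
      with False show ?thesis by (simp only: if_False)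
    qed
  qed
qed

section \<open>Isomorphisms as injective relabellings, and copies as triples\<close>

definition map_graph :: "('a \<Rightarrow> 'b) \<Rightarrow> 'a pair_pre_digraph \<Rightarrow> 'b pair_pre_digraph" where
  "map_graph f G = \<lparr> pverts = f ` pverts G, parcs = map_prod f f ` parcs G \<rparr>"

lemma map_graph_simps [simp]:
  "pverts (map_graph f G) = f ` pverts G"
  "parcs (map_graph f G) = map_prod f f ` parcs G"
  by (simp_all add: map_graph_def)

text \<open>An isomorphism record also carries an arc map and new tail and head functions. With
  \<open>with_proj\<close> on both sides the latter are \<open>fst\<close> and \<open>snd\<close>,
  so the vertex map determines the arc map on the arcs of \<open>G\<close>.\<close>

lemma digraph_iso_with_proj_iff:
  assumes "pair_wf_digraph G"
  shows "digraph_iso (with_proj G) (with_proj S) \<longleftrightarrow>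
    (\<exists>f. inj_on f (pverts G) \<and> S = map_graph f G)"
proof
  assume "digraph_iso (with_proj G) (with_proj S)"
  then obtain h where h: "pre_digraph.digraph_isomorphism (with_proj G) h"
    and S: "with_proj S = app_iso h (with_proj G)"
    by (auto simp: digraph_iso_def)
  from S have "verts (with_proj S) = verts (app_iso h (with_proj G))"
    "arcs (with_proj S) = arcs (app_iso h (with_proj G))"
    "tail (with_proj S) = tail (app_iso h (with_proj G))"
    "head (with_proj S) = head (app_iso h (with_proj G))"
    by simp_all
  then have vS: "pverts S = iso_verts h ` pverts G" and aS: "parcs S = iso_arcs h ` parcs G"
    and t: "iso_tail h = fst" "iso_head h = snd"
    by simp_all
  have "iso_arcs h e = map_prod (iso_verts h) (iso_verts h) e" if "e \<in> parcs G" for e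
    using h that unfolding pre_digraph.digraph_isomorphism_def t
    by (auto simp: prod_eq_iff)
  then have "S = map_graph (iso_verts h) G"
    using vS aS by (intro pair_pre_digraph.equality) (simp_all cong: image_cong)
  moreover have "inj_on (iso_verts h) (pverts G)"
    using h by (simp add: pre_digraph.digraph_isomorphism_def)
  ultimately show "\<exists>f. inj_on f (pverts G) \<and> S = map_graph f G" by blast
next
  assume "\<exists>f. inj_on f (pverts G) \<and> S = map_graph f G"
  then obtain f where f: "inj_on f (pverts G)" and S: "S = map_graph f G" by blast
  interpret pair_wf_digraph G by fact
  let ?h = "\<lparr> iso_verts = f, iso_arcs = map_prod f f, iso_head = snd, iso_tail = fst \<rparr>"
  have "parcs G \<subseteq> pverts G \<times> pverts G"
    using arc_fst_in_verts arc_snd_in_verts by force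
  then have "inj_on (map_prod f f) (parcs G)"
    using map_prod_inj_on[OF f f] by (rule inj_on_subset[rotated])
  then have "pre_digraph.digraph_isomorphism (with_proj G) ?h"
    using f wf_digraph by (simp add: pre_digraph.digraph_isomorphism_def)
  moreover have "with_proj S = app_iso ?h (with_proj G)"
    by (simp add: S app_iso_def with_proj_def)
  ultimately show "digraph_iso (with_proj G) (with_proj S)"
    unfolding digraph_iso_def by blast
qed

fun attach :: "'a set \<times> 'a \<times> 'a set \<Rightarrow> 'a pair_pre_digraph" where
  "attach (L, v, N) = \<lparr> pverts = insert v L,
     parcs = {(x, y). x \<in> L \<and> y \<in> L \<and> x \<noteq> y} \<union> N \<times> {v} \<union> {v} \<times> N \<rparr>"

definition attach_data :: "nat \<Rightarrow> nat \<Rightarrow> ('a set \<times> 'a \<times> 'a set) set" where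
  "attach_data l j = {(L, v, N). finite L \<and> card L = l \<and> v \<notin> L \<and> N \<subseteq> L \<and> card N = j}"

lemma pair_graphI:
  assumes "finite (pverts G)" "parcs G \<subseteq> pverts G \<times> pverts G" "sym (parcs G)"
    and "\<And>x y. (x, y) \<in> parcs G \<Longrightarrow> x \<noteq> y"
  shows "pair_graph G"
proof -
  have "finite (parcs G)"
    by (rule finite_subset[OF assms(2)]) (simp add: assms(1))
  with assms show ?thesis
    by unfold_locales (auto simp: symmetric_def)
qed

lemma pair_graph_attach:
  assumes "d \<in> attach_data l j"
  shows "pair_graph (attach d)"
proof -
  obtain L v N where d: "d = (L, v, N)" by (cases d)
  have L: "finite L" "v \<notin> L" and N: "N \<subseteq> L"
    using assms by (simp_all add: attach_data_def d)
  show ?thesis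
  proof (rule pair_graphI)
    show "finite (pverts (attach d))" using L(1) by (simp add: d)
    show "parcs (attach d) \<subseteq> pverts (attach d) \<times> pverts (attach d)"
      using N unfolding d attach.simps pair_pre_digraph.simps by blast
    show "sym (parcs (attach d))"
      unfolding d attach.simps pair_pre_digraph.simps sym_def by blast
    show "x \<noteq> y" if "(x, y) \<in> parcs (attach d)" for x y
      using that L(2) N unfolding d attach.simps pair_pre_digraph.simps by blast
  qed
qed

lemma map_graph_attach:
  assumes "inj_on f (insert v L)" "N \<subseteq> L"
  shows "map_graph f (attach (L, v, N)) = attach (f ` L, f v, f ` N)"
proof (rule pair_pre_digraph.equality)
  have "map_prod f f ` {(x, y). x \<in> L \<and> y \<in> L \<and> x \<noteq> y} =
      {(x, y). x \<in> f ` L \<and> y \<in> f ` L \<and> x \<noteq> y}"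
    using assms(1) by (force simp: inj_on_def image_iff)
  then show "parcs (map_graph f (attach (L, v, N))) = parcs (attach (f ` L, f v, f ` N))"
    by (auto simp: image_Un)
qed simp_all

lemma attach_data_map:
  assumes "(L, v, N) \<in> attach_data l j" "inj_on f (insert v L)"
  shows "(f ` L, f v, f ` N) \<in> attach_data l j"
proof -
  have "inj_on f L" "inj_on f N"
    using assms by (auto simp: attach_data_def intro: inj_on_subset)
  then show ?thesis
    using assms by (auto simp: attach_data_def card_image)
qed

text \<open>The numbers \<open>l\<close> and \<open>j\<close> determine the graph up to isomorphism:
  bijections from \<open>N\<close> to \<open>N'\<close> and from \<open>L - N\<close> to
  \<open>L' - N'\<close> are glued, and \<open>v\<close> goes to \<open>v'\<close>.\<close>

lemma attach_data_iso:
  assumes "(L, v, N) \<in> attach_data l j" "(L', v', N') \<in> attach_data l j"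
  shows "\<exists>f. inj_on f (insert v L) \<and> attach (L', v', N') = map_graph f (attach (L, v, N))"
proof -
  have N: "finite N" "finite N'" "card N = card N'" "N \<subseteq> L" "N' \<subseteq> L'"
    and L: "finite L" "finite L'" "card L = card L'" and v: "v \<notin> L" "v' \<notin> L'"
    using assms by (auto simp: attach_data_def dest: finite_subset)
  obtain g where g: "bij_betw g N N'"
    using finite_same_card_bij[OF N(1-3)] by blast
  have "card (L - N) = card (L' - N')"
    using N L by (simp add: card_Diff_subset)
  then obtain h where h: "bij_betw h (L - N) (L' - N')"
    using finite_same_card_bij[of "L - N" "L' - N'"] L by auto
  define f where "f x = (if x \<in> N then g x else if x \<in> L then h x else v')" for x
  have fN: "bij_betw f N N'"
    using g by (rule bij_betw_cong[THEN iffD1, rotated]) (simp add: f_def)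
  have "bij_betw f (L - N) (L' - N')"
    using h by (rule bij_betw_cong[THEN iffD1, rotated]) (simp add: f_def)
  from bij_betw_combine[OF fN this] have fL: "bij_betw f L L'"
    using N(4,5) by (simp add: Un_absorb1)
  have fv: "f v = v'" using v N(4) by (auto simp: f_def)
  have "inj_on f (insert v L)"
    using fL fv v by (auto simp: bij_betw_def)
  moreover have "f ` L = L'" "f ` N = N'"
    using fL fN by (auto simp: bij_betw_def)
  ultimately show ?thesis
    using map_graph_attach[of f v L N] N(4) fv by auto
qed

lemma subgraph_with_proj_iff:
  assumes "pair_graph S" "pair_graph G"
  shows "subgraph (with_proj S) (with_proj G) \<longleftrightarrow> pverts S \<subseteq> pverts G \<and> parcs S \<subseteq> parcs G"
proof -
  interpret S: pair_graph S by fact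
  interpret G: pair_graph G by fact
  show ?thesis
    using S.wf_digraph G.wf_digraph by (simp add: subgraph_def compatible_def)
qed

text \<open>This separates the shape of a triple from its position: whether a triple of the right
  shape is counted in \<open>G\<close> depends on the graph \<open>attach d\<close> alone.\<close>

lemma attachments_eq:
  assumes "pair_graph G"
  shows "attachments (pverts G) (parcs G) l j =
    {d \<in> attach_data l j. subgraph (with_proj (attach d)) (with_proj G)}"
proof -
  interpret pair_graph G by fact
  have "(L, v, N) \<in> attachments (pverts G) (parcs G) l j \<longleftrightarrow>
      (L, v, N) \<in> attach_data l j \<and> subgraph (with_proj (attach (L, v, N))) (with_proj G)" for L v N
  proof -
    have "finite L" if "L \<subseteq> pverts G"
      using that pair_finite_verts by (rule finite_subset)
    then have "(L, v, N) \<in> attachments (pverts G) (parcs G) l j \<longleftrightarrow>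
        (L, v, N) \<in> attach_data l j \<and> insert v L \<subseteq> pverts G \<and>
        {(x, y). x \<in> L \<and> y \<in> L \<and> x \<noteq> y} \<subseteq> parcs G \<and> N \<times> {v} \<subseteq> parcs G"
      by (auto simp: attachments_def attach_data_def cliques_def)
    \<comment> \<open>\<open>attachments\<close> asks for one orientation of each joining edge, the
      subgraph relation for both; symmetry of \<open>G\<close> bridges this.\<close>
    also have "N \<times> {v} \<subseteq> parcs G \<longleftrightarrow> N \<times> {v} \<union> {v} \<times> N \<subseteq> parcs G"
      by (auto intro: arcs_symmetric)
    also have "(L, v, N) \<in> attach_data l j \<and> insert v L \<subseteq> pverts G \<and>
        {(x, y). x \<in> L \<and> y \<in> L \<and> x \<noteq> y} \<subseteq> parcs G \<and> N \<times> {v} \<union> {v} \<times> N \<subseteq> parcs G \<longleftrightarrow>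
        (L, v, N) \<in> attach_data l j \<and> subgraph (with_proj (attach (L, v, N))) (with_proj G)"
      using subgraph_with_proj_iff[OF pair_graph_attach assms, of "(L, v, N)" l j]
      by (simp add: Un_assoc cong: conj_cong)
    finally show ?thesis .
  qed
  then show ?thesis by auto
qed

text \<open>By \<open>attach_data_iso\<close> and \<open>attach_data_map\<close>, the graphs
  isomorphic to \<open>attach d\<close> are exactly those coded by triples with the same
  \<open>l\<close> and \<open>j\<close>.\<close>

lemma copies_attach:
  assumes d: "d \<in> attach_data l j" and G: "pair_graph G"
  shows "copies (attach d) G = attach ` attachments (pverts G) (parcs G) l j"
proof -
  obtain L v N where dd: "d = (L, v, N)" by (cases d)
  interpret D: pair_graph "attach d" using d by (rule pair_graph_attach)
  have iso: "digraph_iso (with_proj (attach d)) (with_proj S) \<longleftrightarrow>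
      (\<exists>f. inj_on f (insert v L) \<and> S = map_graph f (attach d))" for S :: "'b pair_pre_digraph"
    using digraph_iso_with_proj_iff[OF D.pair_wf_digraph, of S] by (simp add: dd)
  have "digraph_iso (with_proj (attach d)) (with_proj S) \<longleftrightarrow> S \<in> attach ` attach_data l j"
    for S :: "'b pair_pre_digraph"
  proof
    assume "digraph_iso (with_proj (attach d)) (with_proj S)"
    then obtain f where f: "inj_on f (insert v L)" and S: "S = map_graph f (attach d)"
      using iso by blast
    have "N \<subseteq> L" using d by (simp add: attach_data_def dd)
    then show "S \<in> attach ` attach_data l j"
      using attach_data_map[of L v N l j f] map_graph_attach[OF f] d f
      unfolding S dd by blast
  next
    assume "S \<in> attach ` attach_data l j"
    then obtain L' v' N' where "(L', v', N') \<in> attach_data l j" "S = attach (L', v', N')"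
      by auto
    then show "digraph_iso (with_proj (attach d)) (with_proj S)"
      using attach_data_iso[of L v N l j L' v' N'] d iso unfolding dd by blast
  qed
  then have "copies (attach d) G =
      {S. pair_graph S \<and> subgraph (with_proj S) (with_proj G) \<and> S \<in> attach ` attach_data l j}"
    by (simp add: copies_def)
  also have "\<dots> = attach ` attachments (pverts G) (parcs G) l j"
    unfolding attachments_eq[OF G] using pair_graph_attach by fast
  finally show ?thesis .
qed

lemma finite_attach_fibre: "finite {e \<in> attach_data l j. attach e = attach d}"
proof (rule finite_subset)
  \<comment> \<open>\<open>d\<close> is arbitrary here, so its graph may be infinite; no triple with
    finite \<open>L\<close> codes it then, and the fibre is empty.\<close>
  show "{e \<in> attach_data l j. attach e = attach d} \<subseteq>
      (if finite (pverts (attach d)) then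
        Pow (pverts (attach d)) \<times> pverts (attach d) \<times> Pow (pverts (attach d)) else {})"
  proof
    fix e assume "e \<in> {e \<in> attach_data l j. attach e = attach d}"
    moreover obtain L v N where "e = (L, v, N)" by (cases e)
    ultimately have e: "e = (L, v, N)" "finite L" "N \<subseteq> L" "attach (L, v, N) = attach d"
      by (simp_all add: attach_data_def)
    from arg_cong[OF e(4), of pverts] have "insert v L = pverts (attach d)" by simp
    with e(1-3) show "e \<in> (if finite (pverts (attach d)) then
        Pow (pverts (attach d)) \<times> pverts (attach d) \<times> Pow (pverts (attach d)) else {})"
      by (metis (no_types, lifting) Pow_iff SigmaI finite_insert insertI1 order_trans subset_insertI)
  qed
qed simp

text \<open>An isomorphism from \<open>attach d\<close> to \<open>attach d'\<close> sends the
  triples that code the former injectively to triples that code the latter. Exchanging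
  \<open>d\<close> and \<open>d'\<close>, whose vertex types may differ, gives equality.\<close>

lemma card_attach_fibre_le:
  assumes "d \<in> attach_data l j" "d' \<in> attach_data l j"
  shows "card {e \<in> attach_data l j. attach e = attach d} \<le>
    card {e \<in> attach_data l j. attach e = attach d'}"
proof -
  obtain L v N L' v' N' where dd: "d = (L, v, N)" "d' = (L', v', N')"
    by (cases d, cases d')
  obtain f where f: "inj_on f (insert v L)" and d': "attach d' = map_graph f (attach d)"
    using attach_data_iso[OF assms[unfolded dd]] unfolding dd by blast
  let ?F = "\<lambda>(L, v, N). (f ` L, f v, f ` N)"
  let ?X = "{e \<in> attach_data l j. attach e = attach d}"
  \<comment> \<open>All triples of the fibre live on the vertex set of \<open>attach d\<close>,
    where \<open>f\<close> is injective.\<close>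
  have verts: "insert w M = insert v L \<and> P \<subseteq> M" if "(M, w, P) \<in> ?X" for M w P
    using that by (auto simp: attach_data_def dd)
  show ?thesis
  proof (rule card_inj_on_le[where f = ?F])
    show "inj_on ?F ?X"
    proof (rule inj_onI)
      fix x y assume xy: "x \<in> ?X" "y \<in> ?X" "?F x = ?F y"
      obtain M w P M' w' P' where eq: "x = (M, w, P)" "y = (M', w', P')"
        by (cases x, cases y)
      have sub: "M \<subseteq> insert v L" "M' \<subseteq> insert v L" "w \<in> insert v L" "w' \<in> insert v L"
        "P \<subseteq> insert v L" "P' \<subseteq> insert v L"
        using verts[of M w P] verts[of M' w' P'] xy unfolding eq by blast+
      show "x = y"
        using xy(3) inj_on_image_eq_iff[OF f sub(1,2)] inj_on_image_eq_iff[OF f sub(5,6)]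
          inj_on_eq_iff[OF f sub(3,4)] by (simp add: eq)
    qed
    show "?F ` ?X \<subseteq> {e \<in> attach_data l j. attach e = attach d'}"
    proof
      fix y assume "y \<in> ?F ` ?X"
      then obtain M w P where x: "(M, w, P) \<in> ?X" and y: "y = (f ` M, f w, f ` P)"
        by auto
      have "inj_on f (insert w M)" "P \<subseteq> M" using verts[OF x] f by auto
      then have "y \<in> attach_data l j" "attach y = map_graph f (attach (M, w, P))"
        using attach_data_map[of M w P l j f] x unfolding y by (blast, metis map_graph_attach)
      moreover have "attach (M, w, P) = attach d" using x by blast
      ultimately show "y \<in> {e \<in> attach_data l j. attach e = attach d'}"
        by (metis (mono_tags, lifting) d' mem_Collect_eq)
    qed
  qed (rule finite_attach_fibre)
qed

text \<open>A copy of \<^term>\<open>attach d\<close> arises from several triples only when the attached vertex can be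
  exchanged with a vertex of the clique; the number of triples depends on the isomorphism type only.\<close>

lemma card_attachments_eq_copies:
  assumes d: "d \<in> attach_data l j" and G: "pair_graph G"
  shows "card (attachments (pverts G) (parcs G) l j) =
    card {e \<in> attach_data l j. attach e = attach d} * num_copies (attach d) G"
proof -
  interpret pair_graph G by fact
  let ?A = "attachments (pverts G) (parcs G) l j"
  let ?c = "card {e \<in> attach_data l j. attach e = attach d}"
  have finA: "finite ?A"
  proof (rule finite_subset)
    show "?A \<subseteq> Pow (pverts G) \<times> pverts G \<times> Pow (pverts G)"
      by (auto simp: attachments_def cliques_def)
  qed (simp add: pair_finite_verts)
  have fibre: "card {e \<in> ?A. attach e = S} = ?c" if S: "S \<in> attach ` ?A" for S
  proof -
    obtain e where e: "e \<in> ?A" "S = attach e" using S by blast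
    then have "e \<in> attach_data l j" by (simp add: attachments_eq[OF G])
    \<comment> \<open>Lying in \<open>G\<close> is a property of the coded graph, so this fibre is
      contained in \<open>?A\<close> as a whole.\<close>
    moreover have "{e \<in> ?A. attach e = S} = {e' \<in> attach_data l j. attach e' = attach e}"
      using e by (auto simp: attachments_eq[OF G])
    ultimately show ?thesis
      using card_attach_fibre_le[OF d, of e] card_attach_fibre_le[OF _ d, of e]
      by (metis (no_types, lifting) le_antisym)
  qed
  have "card ?A = (\<Sum>e\<in>?A. 1)" by simp
  also have "\<dots> = (\<Sum>S\<in>attach ` ?A. \<Sum>e\<in>{e \<in> ?A. attach e = S}. 1)"
    using finA by (intro sum.group[symmetric]) auto
  also have "\<dots> = (\<Sum>S\<in>attach ` ?A. ?c)"
    by (intro sum.cong refl) (simp add: fibre)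
  also have "\<dots> = ?c * num_copies (attach d) G"
    by (simp add: num_copies_def copies_attach[OF d G])
  finally show ?thesis .
qed

section \<open>Complete subgraphs and balanced classes\<close>

text \<open>A copy of \<open>K_k\<close> carries all arcs on its vertex set, so it amounts to a
  \<open>k\<close>-clique.\<close>

lemma free_of_complete_iff:
  assumes G: "pair_graph G"
  shows "free_of (complete_pair_graph k) G \<longleftrightarrow> cliques (pverts G) (parcs G) k = {}"
proof -
  let ?K = "complete_pair_graph k"
  have wf: "pair_wf_digraph ?K"
    by unfold_locales (auto simp: complete_pair_graph_def)
  note iso = digraph_iso_with_proj_iff[OF wf]
  have map: "map_graph f ?K = \<lparr> pverts = f ` {..<k},
      parcs = {(x, y). x \<in> f ` {..<k} \<and> y \<in> f ` {..<k} \<and> x \<noteq> y} \<rparr>"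
    if "inj_on f {..<k}" for f :: "nat \<Rightarrow> 'a"
  proof (rule pair_pre_digraph.equality)
    show "parcs (map_graph f ?K) = parcs \<lparr> pverts = f ` {..<k},
        parcs = {(x, y). x \<in> f ` {..<k} \<and> y \<in> f ` {..<k} \<and> x \<noteq> y} \<rparr>"
      using that by (force simp: complete_pair_graph_def inj_on_def image_iff)
  qed (auto simp: complete_pair_graph_def)
  show ?thesis
  proof
    assume free: "free_of ?K G"
    show "cliques (pverts G) (parcs G) k = {}"
    proof (rule ccontr)
      assume "cliques (pverts G) (parcs G) k \<noteq> {}"
      then obtain Q where Q: "Q \<in> cliques (pverts G) (parcs G) k" by blast
      interpret pair_graph G by fact
      have finQ: "finite Q" using finite_clique[OF pair_finite_verts Q] .
      then obtain f where "bij_betw f {..<k} Q"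
        using finite_same_card_bij[of "{..<k}" Q] cliquesD(2)[OF Q] by auto
      then have f: "inj_on f {..<k}" "f ` {..<k} = Q" by (auto simp: bij_betw_def)
      define S where "S = map_graph f ?K"
      have S: "S = \<lparr> pverts = Q, parcs = {(x, y). x \<in> Q \<and> y \<in> Q \<and> x \<noteq> y} \<rparr>"
        using map[OF f(1)] f(2) by (simp add: S_def)
      have pg: "pair_graph S"
        using finQ by (intro pair_graphI) (auto simp: S sym_def)
      have "subgraph (with_proj S) (with_proj G)"
        unfolding subgraph_with_proj_iff[OF pg G] using cliquesD[OF Q] by (auto simp: S)
      moreover have "digraph_iso (with_proj ?K) (with_proj S)"
        using f(1) unfolding iso by (intro exI[of _ f]) (simp add: S_def complete_pair_graph_def)
      ultimately show False
        using free pg by (auto simp: free_of_def copies_def)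
    qed
  next
    assume empty: "cliques (pverts G) (parcs G) k = {}"
    show "free_of ?K G"
      unfolding free_of_def
    proof (rule ccontr)
      assume "copies ?K G \<noteq> {}"
      then obtain S where S: "pair_graph S" "subgraph (with_proj S) (with_proj G)"
        "digraph_iso (with_proj ?K) (with_proj S)"
        by (auto simp: copies_def)
      then obtain f where f: "inj_on f {..<k}" and Sf: "S = map_graph f ?K"
        unfolding iso by (auto simp: complete_pair_graph_def)
      have "pverts S \<subseteq> pverts G" "parcs S \<subseteq> parcs G"
        using S(2) subgraph_with_proj_iff[OF S(1) G] by simp_all
      then have "f ` {..<k} \<in> cliques (pverts G) (parcs G) k"
        using f unfolding Sf map[OF f] by (intro cliquesI) (auto simp: card_image)
      with empty show False by simp
    qed
  qed
qed

text \<open>Floor and ceiling differ by at most one. Unlike the exact class sizes, pairwise balance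
  does not mention \<open>n\<close>, which suits an induction that removes vertices.\<close>

lemma turan_graph_balanced:
  assumes "is_turan_graph r n T"
  obtains c where "\<forall>w\<in>pverts T. c w < r"
    and "parcs T = {(u, v). u \<in> pverts T \<and> v \<in> pverts T \<and> c u \<noteq> c v}"
    and "\<forall>i<r. \<forall>j<r. card {w \<in> pverts T. c w = i} \<le> Suc (card {w \<in> pverts T. c w = j})"
proof -
  obtain c where c: "\<forall>w\<in>pverts T. c w < r"
      "parcs T = {(u, v). u \<in> pverts T \<and> v \<in> pverts T \<and> c u \<noteq> c v}"
    and b: "\<And>i. i < r \<Longrightarrow> int (card {w \<in> pverts T. c w = i}) \<in> {\<lfloor>real n / real r\<rfloor>, \<lceil>real n / real r\<rceil>}"
    using assms unfolding is_turan_graph_def by blast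
  have fc: "\<lfloor>real n / real r\<rfloor> \<le> \<lceil>real n / real r\<rceil>" "\<lceil>real n / real r\<rceil> \<le> \<lfloor>real n / real r\<rfloor> + 1"
    by linarith+
  have "card {w \<in> pverts T. c w = i} \<le> Suc (card {w \<in> pverts T. c w = j})" if "i < r" "j < r" for i j
  proof -
    have "int (card {w \<in> pverts T. c w = i}) \<le> \<lceil>real n / real r\<rceil>"
      using b[OF that(1)] fc(1) by auto
    moreover have "\<lfloor>real n / real r\<rfloor> \<le> int (card {w \<in> pverts T. c w = j})"
      using b[OF that(2)] fc(1) by auto
    ultimately show ?thesis using fc(2) by linarith
  qed
  with c show ?thesis by (intro that[of c]) blast+
qed

section \<open>Turan-goodness\<close>

theorem turan_good_attach:
  assumes d: "d \<in> attach_data l j" and l: "l \<ge> 1" and k: "k \<ge> l + 1"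
    and free: "free_of (complete_pair_graph k) (attach d)"
  shows "turan_good k (attach d)"
  unfolding turan_good_def
proof (intro conjI always_eventually allI impI free)
  fix n :: nat and T :: "nat pair_pre_digraph"
  define r where "r = k - 1"
  have r: "r > 0" "k = Suc r" using l k by (auto simp: r_def)
  assume "is_turan_graph (k - 1) n T"
  then have turan: "is_turan_graph r n T" by (simp add: r_def)
  then have T: "pair_graph T" "card (pverts T) = n" by (auto simp: is_turan_graph_def)
  obtain c where c: "\<forall>w\<in>pverts T. c w < r"
    and arcs: "parcs T = {(u, v). u \<in> pverts T \<and> v \<in> pverts T \<and> c u \<noteq> c v}"
    and bal: "\<forall>i<r. \<forall>j<r. card {w \<in> pverts T. c w = i} \<le> Suc (card {w \<in> pverts T. c w = j})"
    using turan_graph_balanced[OF turan] by blast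
  let ?C = "{(u, v). c u \<noteq> c v}"
  interpret T: pair_graph T by fact
  note finT = T.pair_finite_verts
  have cl: "cliques (pverts T) (parcs T) s = cliques (pverts T) ?C s" for s
    unfolding arcs cliques_def by blast
  have att: "attachments (pverts T) (parcs T) l j = attachments (pverts T) ?C l j"
    unfolding attachments_def cl by (auto simp: arcs dest: cliquesD(1))
  \<comment> \<open>A clique injects into the \<open>r\<close> classes. Hence \<open>T\<close>
    itself is among the graphs over which the maximum is taken.\<close>
  have "cliques (pverts T) ?C (Suc r) = {}"
  proof (rule ccontr)
    assume "cliques (pverts T) ?C (Suc r) \<noteq> {}"
    then obtain Q where Q: "Q \<in> cliques (pverts T) ?C (Suc r)" by blast
    have "card Q \<le> card {..<r}"
      using c cliquesD(1)[OF Q] by (intro card_inj_on_le[OF inj_on_clique[OF Q]]) auto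
    then show False using cliquesD(2)[OF Q] by simp
  qed
  then have Tfree: "free_of (complete_pair_graph k) T"
    unfolding free_of_complete_iff[OF T(1)] cl r(2) .
  have max: "num_copies (attach d) G \<le> num_copies (attach d) T"
    if G: "pair_graph G" "card (pverts G) = n" "free_of (complete_pair_graph k) G"
    for G :: "nat pair_pre_digraph"
  proof -
    interpret G: pair_graph G by fact
    have sym: "sym (parcs G)" using G.arcs_symmetric by (auto simp: sym_def)
    have Gfree: "cliques (pverts G) (parcs G) (Suc r) = {}"
      using G(3) unfolding free_of_complete_iff[OF G(1)] r(2) .
    have zykov: "card (cliques (pverts G) (parcs G) s) \<le> card (cliques (pverts T) ?C s)" for s
      using G.pair_finite_verts finT G(2) T(2) sym Gfree c bal r(1)
      by (intro card_cliques_le_turan) auto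
    let ?m = "card {e \<in> attach_data l j. attach e = attach d}"
    have "?m * num_copies (attach d) G = card (attachments (pverts G) (parcs G) l j)"
      by (rule card_attachments_eq_copies[OF d G(1), symmetric])
    also have "\<dots> \<le> attachment_bound (pverts G) (parcs G) l j"
      by (rule card_attachments_le[OF G.pair_finite_verts sym])
    \<comment> \<open>Both graphs have \<open>n\<close> vertices, so the coefficients agree; only
      the numbers of \<open>l\<close>- and \<open>(l+1)\<close>-cliques differ.\<close>
    also have "\<dots> \<le> attachment_bound (pverts T) ?C l j"
      unfolding attachment_bound_def G(2) T(2) by (intro add_mono mult_left_mono zykov) auto
    also have "\<dots> = card (attachments (pverts T) (parcs T) l j)"
      unfolding att by (rule card_attachments_multipartite[OF finT, symmetric])
    also have "\<dots> = ?m * num_copies (attach d) T"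
      by (rule card_attachments_eq_copies[OF d T(1)])
    finally have "?m * num_copies (attach d) G \<le> ?m * num_copies (attach d) T" .
    \<comment> \<open>\<open>d\<close> belongs to its own fibre, and finiteness keeps
      \<open>card\<close> from defaulting to 0.\<close>
    moreover have "?m > 0"
      using d finite_attach_fibre[of l j d] unfolding card_gt_0_iff by blast
    ultimately show ?thesis by simp
  qed
  show "turan_number n (attach d) (complete_pair_graph k) = num_copies (attach d) T"
    unfolding turan_number_def
    using finite_num_copies_values max T Tfree by (intro Max_eqI) blast+
qed

theorem proposition2p1:
  fixes l k :: nat
    and A B H :: "'a pair_pre_digraph"
    and J :: "('a \<times> 'a) set"
  assumes "l \<ge> 1" and "k \<ge> l + 1"
    and "K\<^bsub>l\<^esub> (with_proj A)" and "K\<^bsub>1\<^esub> (with_proj B)"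
    and "pverts A \<inter> pverts B = {}"
    and "J \<subseteq> pverts A \<times> pverts B"
    and "pverts H = pverts A \<union> pverts B"
    and "parcs H = parcs A \<union> parcs B \<union> J \<union> J\<inverse>"
    and "\<not> K\<^bsub>l + 1\<^esub> (with_proj H)"
  shows "turan_good k H"
proof -
  have A: "finite (pverts A)" "card (pverts A) = l"
      "parcs A = {(x, y). x \<in> pverts A \<and> y \<in> pverts A \<and> x \<noteq> y}"
    using assms(3) by (simp_all add: complete_digraph_pair_def)
  obtain b where b: "pverts B = {b}" and B: "parcs B = {}"
    using assms(4) by (auto simp: complete_digraph_pair_def card_1_singleton_iff)
  define N where "N = {u. (u, b) \<in> J}"
  have J: "J\<inverse> = {b} \<times> N" "J = N \<times> {b}"
    using assms(6) by (auto simp: N_def b)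
  have data: "(pverts A, b, N) \<in> attach_data l (card N)"
    using A assms(5,6) by (auto simp: attach_data_def b N_def)
  have H: "H = attach (pverts A, b, N)"
    using assms(7,8) by (intro pair_pre_digraph.equality) (simp_all add: A(3) b B J(1), simp add: J(2))
  have pg: "pair_graph H"
    unfolding H using data by (rule pair_graph_attach)
  interpret H: pair_graph H by (rule pg)
  have finH: "finite (pverts H)" and cardH: "card (pverts H) = l + 1"
    using A assms(5,7) b by auto
  have "cliques (pverts H) (parcs H) k = {}"
  proof (rule ccontr)
    assume "cliques (pverts H) (parcs H) k \<noteq> {}"
    then obtain Q where Q: "Q \<in> cliques (pverts H) (parcs H) k" by blast
    \<comment> \<open>\<open>H\<close> has only \<open>l + 1 \<le> k\<close> vertices, so a
      \<open>k\<close>-clique would be all of \<open>H\<close> and make it a complete graph, against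
      the assumption.\<close>
    then have "Q = pverts H"
      using finH cardH assms(2) by (intro card_seteq) (auto dest: cliquesD)
    then have "(u, v) \<in> parcs H \<longleftrightarrow> u \<in> pverts H \<and> v \<in> pverts H \<and> u \<noteq> v" for u v
      using cliquesD(3)[OF Q, of u v] H.wellformed'[of u v] H.no_loops'[of u v] by blast
    then have "parcs H = {(u, v). (u, v) \<in> pverts H \<times> pverts H \<and> u \<noteq> v}"
      by blast
    then show False
      using assms(9) finH cardH by (simp add: complete_digraph_pair_def)
  qed
  then have "free_of (complete_pair_graph k) H"
    unfolding free_of_complete_iff[OF pg] .
  then show ?thesis
    unfolding H using data assms(1,2) by (intro turan_good_attach)
qed

end
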